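(* Let $r\ge1$, let $p_1,\dots,p_r\ge5$ be distinct primes, $P=p_1\cdots p_r$ and $M=6P$. For every positive integer $n$, $$\#\mathcal R_P(n)=\kappa_P(n).$$
   Context: For $q\in\mathbb Z_{>0}$, $x\in\mathbb Z$, $\delta_q(x)=x-q\lfloor x/q\rfloor$. $\mathbf 1_{\{\cdot\}}$ denotes an indicator. $$\mathcal R_P(n)=\{c\in\{0,\dots,M-1\}:\gcd(c,M)=1,\ \gcd(\delta_M(2n-c),M)=1\}.$$ With $\varepsilon_i(n)=\mathbf 1_{\{\delta_{p_i}(n)=0\}}$, $$\kappa_P(n)=\bigl(1+\mathbf 1_{\{\delta_3(n)=0\}}\bigr)\prod_{i=1}^r\bigl(p_i-2+\varepsilon_i(n)\bigr).$$ *)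

theory Defs
  imports Complex_Main "HOL-Number_Theory.Number_Theory"
begin

definition delta :: "nat \<Rightarrow> int \<Rightarrow> int" where
  "delta q x = x - int q * \<lfloor>real_of_int x / real q\<rfloor>"

definition R_set :: "nat \<Rightarrow> nat \<Rightarrow> int set" where
  "R_set P n = (let M = 6 * P in
     {c \<in> {0..int M - 1}. gcd c (int M) = 1 \<and> gcd (delta M (2 * int n - c)) (int M) = 1})"

definition eps :: "(nat \<Rightarrow> nat) \<Rightarrow> nat \<Rightarrow> nat \<Rightarrow> int" where
  "eps p n i = of_bool (delta (p i) (int n) = 0)"

text \<open>The family \<open>p\<close> is indexed by \<open>{1..r}\<close>; values of \<open>p\<close> outside this range are irrelevant.
  The product is integer-valued, so that the subtraction of \<open>2\<close> is not truncated.\<close>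

definition kappa :: "nat \<Rightarrow> (nat \<Rightarrow> nat) \<Rightarrow> nat \<Rightarrow> int" where
  "kappa r p n =
     (1 + of_bool (delta 3 (int n) = 0)) * (\<Prod>i=1..r. int (p i) - 2 + eps p n i)"

end

theory Submission
  imports Defs
begin

text \<open>Since \<open>\<delta>\<^sub>M\<close> is reduction modulo \<open>M\<close>, the set in question consists of the residues \<open>c\<close> modulo
  \<open>M\<close> for which both \<open>c\<close> and \<open>2 n - c\<close> are units. By the Chinese remainder theorem the number of
  these is multiplicative in \<open>M\<close>, and modulo a prime \<open>q\<close> one has to avoid the residues of \<open>0\<close> and
  \<open>2 n\<close>, which coincide precisely when \<open>q\<close> divides \<open>2 n\<close>.\<close>

text \<open>The target \<open>a\<close> is independent of the modulus, so the same \<open>a\<close>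
  serves every factor of \<open>m\<close>. Leaving \<open>a - c\<close> unreduced is harmless, since
  coprimality to \<open>m\<close> sees only residues.\<close>

definition unit_splittings :: "int \<Rightarrow> int \<Rightarrow> int set" where
  "unit_splittings a m = {c \<in> {0..<m}. coprime c m \<and> coprime (a - c) m}"

lemma coprime_cong_int:
  fixes a b m d :: int
  assumes "[a = b] (mod m)" and "d dvd m"
  shows "coprime a d \<longleftrightarrow> coprime b d"
  using cong_dvd_modulus[OF assms] cong_imp_coprime cong_sym by blast

lemma card_unit_splittings_mult:
  fixes m k :: int
  assumes "coprime m k" "m > 0" "k > 0"
  shows "card (unit_splittings a (m * k)) = card (unit_splittings a m) * card (unit_splittings a k)"
proof -
  \<comment> \<open>Both conditions depend only on the residue of \<open>c\<close>, so they pass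
    between \<open>c\<close> and its residues modulo \<open>m\<close> and \<open>k\<close>.\<close>
  have mod_iff: "coprime (c mod d) d \<and> coprime (a - c mod d) d \<longleftrightarrow> coprime c d \<and> coprime (a - c) d"
    for c d :: int
  proof -
    have "[c mod d = c] (mod d)"
      by simp
    moreover from this have "[a - c mod d = a - c] (mod d)"
      by (intro cong_diff cong_refl)
    ultimately show ?thesis
      by (meson coprime_cong_int dvd_refl)
  qed
  have "bij_betw (\<lambda>c. (c mod m, c mod k)) (unit_splittings a (m * k))
          (unit_splittings a m \<times> unit_splittings a k)"
    unfolding bij_betw_def
  proof
    show "inj_on (\<lambda>c. (c mod m, c mod k)) (unit_splittings a (m * k))"
    proof (rule inj_onI)
      fix x y
      assume xy: "x \<in> unit_splittings a (m * k)" "y \<in> unit_splittings a (m * k)"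
        and "(x mod m, x mod k) = (y mod m, y mod k)"
      then have "[x = y] (mod (m * k))"
        using assms(1) by (intro coprime_cong_mult) (auto simp: cong_def)
      with xy show "x = y"
        by (auto simp: unit_splittings_def intro: cong_less_imp_eq_int)
    qed
    show "(\<lambda>c. (c mod m, c mod k)) ` unit_splittings a (m * k) =
        unit_splittings a m \<times> unit_splittings a k"
    proof (intro equalityI subsetI)
      fix z
      assume "z \<in> (\<lambda>c. (c mod m, c mod k)) ` unit_splittings a (m * k)"
      with assms mod_iff show "z \<in> unit_splittings a m \<times> unit_splittings a k"
        by (auto simp: unit_splittings_def)
    next
      fix z
      assume "z \<in> unit_splittings a m \<times> unit_splittings a k"
      then obtain x y where z: "z = (x, y)"
        and x: "x \<in> unit_splittings a m" and y: "y \<in> unit_splittings a k"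
        by blast
      obtain w where w: "[w = x] (mod m)" "[w = y] (mod k)"
        using binary_chinese_remainder_int[OF assms(1)] by blast
      \<comment> \<open>A CRT solution \<open>w\<close> may lie out of range; reducing it modulo
        \<open>m * k\<close> preserves both residues.\<close>
      define c where "c = w mod (m * k)"
      have c: "c mod m = x" "c mod k = y"
        using w x y by (auto simp: c_def cong_def unit_splittings_def mod_mod_cancel)
      have "c \<in> unit_splittings a (m * k)"
        using mod_iff[of c m] mod_iff[of c k] x y assms c
        by (auto simp: unit_splittings_def c_def)
      with c z show "z \<in> (\<lambda>c. (c mod m, c mod k)) ` unit_splittings a (m * k)"
        by force
    qed
  qed
  then show ?thesis
    by (metis bij_betw_same_card card_cartesian_product)
qed

lemma card_unit_splittings_prime:
  fixes q :: int
  assumes "prime q"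
  shows "int (card (unit_splittings a q)) = q - 2 + of_bool (q dvd a)"
proof -
  have q: "q > 1"
    using assms prime_gt_1_int by blast
  have coprime_iff: "coprime c q \<longleftrightarrow> \<not> q dvd c" for c :: int
    using assms by (metis coprime_commute coprime_absorb_left not_prime_unit prime_imp_coprime)
  have "c \<in> unit_splittings a q \<longleftrightarrow> c \<in> {1..<q} - {a mod q}" for c
  proof (cases "c \<in> {0..<q}")
    case True
    then have "c mod q = c"
      by simp
    then have "q dvd c \<longleftrightarrow> c = 0" and "q dvd a - c \<longleftrightarrow> c = a mod q"
      by (simp only: dvd_eq_mod_eq_0, metis mod_eq_dvd_iff)
    with True show ?thesis
      by (auto simp: unit_splittings_def coprime_iff)
  qed (auto simp: unit_splittings_def)
  then have "unit_splittings a q = {1..<q} - {a mod q}"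
    by blast
  \<comment> \<open>Excluding \<open>0\<close> leaves \<open>q - 1\<close> residues; excluding
    \<open>a mod q\<close> costs another one only if it is nonzero, whence the
    \<open>of_bool\<close> term.\<close>
  moreover have "a mod q \<in> {1..<q} \<longleftrightarrow> \<not> q dvd a"
    using q pos_mod_bound[of q a] pos_mod_sign[of q a] unfolding dvd_eq_mod_eq_0 by fastforce
  ultimately show ?thesis
    using q by (auto simp: card_Diff_singleton_if of_nat_diff)
qed

text \<open>Injectivity of \<open>p\<close> makes the primes distinct, hence pairwise coprime, so
  multiplicativity splits them off one at a time.\<close>

lemma card_unit_splittings_prod_primes:
  fixes p :: "'i \<Rightarrow> nat"
  assumes "finite I" "\<And>i. i \<in> I \<Longrightarrow> prime (p i)" "inj_on p I"
  shows "int (card (unit_splittings a (\<Prod>i\<in>I. int (p i)))) =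
    (\<Prod>i\<in>I. int (p i) - 2 + of_bool (int (p i) dvd a))"
  using assms
proof (induction I rule: finite_induct)
  case empty
  \<comment> \<open>Modulo \<open>1\<close> the single residue \<open>0\<close> is a unit, matching
    the empty product.\<close>
  have "unit_splittings a 1 = {0}"
    by (auto simp: unit_splittings_def)
  then show ?case
    by simp
next
  case (insert j I)
  have "coprime (p j) (p i)" if "i \<in> I" for i
    using insert that by (intro primes_coprime) (auto simp: inj_on_def)
  then have "coprime (int (p j)) (\<Prod>i\<in>I. int (p i))"
    by (intro prod_coprime_right) (simp add: coprime_int_iff)
  moreover have "(\<Prod>i\<in>I. int (p i)) > 0"
    using insert by (intro prod_pos) (auto intro: prime_gt_0_nat)
  moreover have "int (p j) > 0"
    using insert by (auto intro: prime_gt_0_nat)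
  ultimately show ?case
    using insert by (simp add: card_unit_splittings_mult card_unit_splittings_prime)
qed

text \<open>The floor of the real quotient is integer division; for \<open>q = 0\<close> both sides
  are \<open>x\<close>.\<close>

lemma delta_eq_mod: "delta q x = x mod int q"
  by (simp add: delta_def floor_divide_of_int_eq[of x "int q", simplified] minus_div_mult_eq_mod[symmetric])

text \<open>Reduction modulo \<open>6 * P\<close> leaves the gcd with \<open>6 * P\<close>
  unchanged, so \<open>delta\<close> drops out.\<close>

lemma R_set_eq_unit_splittings: "R_set P n = unit_splittings (2 * int n) (6 * int P)"
  by (auto simp: R_set_def unit_splittings_def Let_def delta_eq_mod coprime_iff_gcd_eq_1)

theorem proposition4p1:
  fixes r P n :: nat and p :: "nat \<Rightarrow> nat"
  assumes "r \<ge> 1"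
    and "\<And>i. i \<in> {1..r} \<Longrightarrow> prime (p i)"
    and "\<And>i. i \<in> {1..r} \<Longrightarrow> p i \<ge> 5"
    and "inj_on p {1..r}"
    and "P = (\<Prod>i=1..r. p i)"
    and "n > 0"
  shows "int (card (R_set P n)) = kappa r p n"
proof -
  let ?a = "2 * int n"
  \<comment> \<open>Meant for \<open>q = 2\<close> and \<open>q = 3\<close>: the bound
    \<open>p i \<ge> 5\<close> keeps both away from the factors of \<open>P\<close>.\<close>
  have coprime_P: "coprime q (int P)" if "prime q" "q < 5" for q :: int
  proof -
    have "coprime q (int (p i))" if "i \<in> {1..r}" for i
      using \<open>prime q\<close> \<open>q < 5\<close> assms(2,3)[OF that] by (intro primes_coprime) auto
    then show ?thesis
      unfolding assms(5) of_nat_prod by (intro prod_coprime_right)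
  qed
  have P: "int P > 0"
    using assms(2) unfolding assms(5) of_nat_prod by (intro prod_pos) (auto intro: prime_gt_0_nat)
  have c2: "coprime (2 :: int) (3 * int P)" and c3: "coprime (3 :: int) (int P)"
    using coprime_P[of 2] coprime_P[of 3] by auto
  \<comment> \<open>At an odd prime \<open>2\<close> is invertible, which is why
    \<open>kappa\<close> can test \<open>n\<close> although the sum to split is
    \<open>2 * n\<close>.\<close>
  have dvd_double: "q dvd ?a \<longleftrightarrow> q dvd int n" if "prime q" "q \<noteq> 2" for q :: int
    using that primes_coprime[of q 2] by (simp add: coprime_dvd_mult_right_iff)
  have "card (R_set P n) = card (unit_splittings ?a (2 * (3 * int P)))"
    by (simp add: R_set_eq_unit_splittings)
  also have "\<dots> = card (unit_splittings ?a 2) * (card (unit_splittings ?a 3) * card (unit_splittings ?a (int P)))"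
    using P card_unit_splittings_mult[OF c2] card_unit_splittings_mult[OF c3] by simp
  \<comment> \<open>The prime 2 divides \<open>2 * n\<close> and contributes
    \<open>2 - 2 + 1 = 1\<close>; the prime 3 contributes \<open>3 - 2\<close> plus its
    indicator.\<close>
  finally have "int (card (R_set P n)) = (1 + of_bool (3 dvd int n)) * int (card (unit_splittings ?a (int P)))"
    using card_unit_splittings_prime[of 2 ?a] card_unit_splittings_prime[of 3 ?a] dvd_double[of 3]
    by simp
  also have "int (card (unit_splittings ?a (int P))) = (\<Prod>i=1..r. int (p i) - 2 + of_bool (int (p i) dvd ?a))"
    unfolding assms(5) of_nat_prod using assms by (intro card_unit_splittings_prod_primes) auto
  also have "\<dots> = (\<Prod>i=1..r. int (p i) - 2 + eps p n i)"
  proof (rule prod.cong)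
    fix i
    assume i: "i \<in> {1..r}"
    show "int (p i) - 2 + of_bool (int (p i) dvd ?a) = int (p i) - 2 + eps p n i"
      using dvd_double[of "int (p i)"] assms(2,3)[OF i]
      by (auto simp: eps_def delta_eq_mod dvd_eq_mod_eq_0)
  qed simp
  finally show ?thesis
    by (simp add: kappa_def delta_eq_mod dvd_eq_mod_eq_0)
qed

end
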